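(* For every integer $n\ge 2$, $$DE_{e1}(n)=\sum_{i=0}^{n-2}(-1)^i\,reg_4(n-1-i).$$
   Context: Notation: $(\alpha;q)_0=1$, $(\alpha;q)_n=\prod_{j=0}^{n-1}(1-\alpha q^j)$, $(\alpha;q)_\infty=\prod_{j=0}^\infty(1-\alpha q^j)$, $|q|<1$. $DE_{e1}(n)$ is the number of partitions of $n$ in which no even part is repeated and the largest part is even and appears exactly once; its generating function is $\sum_{n\ge0}DE_{e1}(n)q^n=\sum_{n\ge 0}\frac{(-q^2;q^2)_n\,q^{2n+2}}{(q;q^2)_{n+1}}$. $reg_4(n)$ is the number of $4$-regular partitions of $n$ (partitions with no part divisible by $4$), with $\sum_{n\ge0}reg_4(n)q^n=\frac{(q^4;q^4)_\infty}{(q;q)_\infty}$. *)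

theory Defs
  imports Main "HOL-Library.Multiset"
begin

definition partitions_of :: "nat \<Rightarrow> nat multiset set" where
  "partitions_of n = {P. 0 \<notin># P \<and> sum_mset P = n}"

lemma finite_partitions_of: "finite (partitions_of n)"
proof (rule finite_subset)
  show "partitions_of n \<subseteq> mset ` {xs. set xs \<subseteq> {..n} \<and> length xs \<le> n}"
  proof
    fix P assume "P \<in> partitions_of n"
    then have P: "0 \<notin># P" "sum_mset P = n" by (auto simp: partitions_of_def)
    obtain xs where xs: "P = mset xs" by (metis ex_mset)
    have sum: "sum_list xs = n" using P xs by (simp add: sum_mset_sum_list)
    have "length xs \<le> sum_list xs" if "0 \<notin> set xs" for xs :: "nat list"
      using that by (induction xs) auto
    then have "length xs \<le> n" using P xs sum by (metis set_mset_mset)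
    moreover have "set xs \<subseteq> {..n}" using sum member_le_sum_list by fastforce
    ultimately show "P \<in> mset ` {xs. set xs \<subseteq> {..n} \<and> length xs \<le> n}" using xs by blast
  qed
  have "finite {xs :: nat list. set xs \<subseteq> {..n} \<and> length xs \<le> n}"
    by (rule finite_lists_length_le) simp
  then show "finite (mset ` {xs :: nat list. set xs \<subseteq> {..n} \<and> length xs \<le> n})"
    by simp
qed

(* The condition P \<noteq> {#} excludes the empty partition of 0, which has no largest part. *)
definition DE_e1 :: "nat \<Rightarrow> nat" where
  "DE_e1 n = card {P \<in> partitions_of n.
     (\<forall>k. even k \<longrightarrow> count P k \<le> 1) \<and>
     P \<noteq> {#} \<and> even (Max (set_mset P)) \<and> count P (Max (set_mset P)) = 1}"

definition reg :: "nat \<Rightarrow> nat \<Rightarrow> nat" where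
  "reg l n = card {P \<in> partitions_of n. \<forall>k \<in># P. \<not> l dvd k}"

end

theory Submission
  imports Defs
begin

text \<open>
  Write \<open>E\<close> for the class of partitions in which no even part is repeated. Two bijections give the
  theorem.

  The first is of the type of Euler and Glaisher: in a partition without parts divisible by \<open>4\<close>,
  merge as many pairs of equal even parts \<open>2k + 2k \<rightarrow> 4k\<close> as possible, for
  \<open>k = 1, 2, 3, \<dots>\<close> in this order. This ends in
  \<open>E\<close> and can be undone, so \<open>reg\<^sub>4(m)\<close> counts the members of \<open>E\<close> of size \<open>m\<close>
  (\<open>reg_mult_eq_card_few_multiples\<close>). On the level of generating functions this is the identity
  \<open>(q\<^sup>4;q\<^sup>4)\<^sub>\<infinity> / (q;q)\<^sub>\<infinity> = (-q\<^sup>2;q\<^sup>2)\<^sub>\<infinity> / (q;q\<^sup>2)\<^sub>\<infinity>\<close>.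

  The second splits the nonempty members of \<open>E\<close> of size \<open>m\<close> by the parity of the largest part. If
  it is even, the partition is one of those counted by \<open>DE\<^sub>e\<^sub>1(m)\<close>. If it is odd, adding \<open>1\<close> to one
  copy of the largest part produces exactly the partitions counted by \<open>DE\<^sub>e\<^sub>1(m + 1)\<close>. Hence
  \<open>DE\<^sub>e\<^sub>1(m + 1) + DE\<^sub>e\<^sub>1(m) = reg\<^sub>4(m)\<close> for \<open>m \<ge> 1\<close> (\<open>DE_e1_Suc_add\<close>), and unrolling this
  recurrence from \<open>DE\<^sub>e\<^sub>1(1) = 0\<close> yields the alternating sum.
\<close>

section \<open>A Glaisher-type theorem for parts divisible by a fixed number\<close>

text \<open>
  The classes met while copies of \<open>d k\<close> are merged \<open>r\<close> at a time, for increasing \<open>k\<close>: the multiples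
  \<open>d j\<close> with \<open>j < k\<close> have been reduced to fewer than \<open>r\<close> copies, and the parts \<open>d r j\<close> with
  \<open>j \<ge> k\<close> have not been created yet.
\<close>

definition merge_stage :: "nat \<Rightarrow> nat \<Rightarrow> nat \<Rightarrow> nat \<Rightarrow> nat multiset set" where
  "merge_stage d r k n = {P \<in> partitions_of n.
     (\<forall>j<k. count P (d * j) < r) \<and> (\<forall>j\<ge>k. count P (d * r * j) = 0)}"

text \<open>
  Merging at \<open>k\<close> amounts to division with remainder: a multiplicity \<open>r a + b\<close> of \<open>d k\<close> together
  with no copy of \<open>d r k\<close> is traded for multiplicities \<open>b < r\<close> and \<open>a\<close>. No other condition is
  affected, because \<open>d r k\<close> is too large to be among the already reduced multiples of \<open>d\<close>, and
  \<open>d k\<close> is too small to be among the multiples of \<open>d r\<close> that must remain absent.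
\<close>

lemma bij_betw_merge_stage:
  fixes d r k n :: nat
  assumes d: "d > 0" and r: "r \<ge> 2" and k: "k > 0"
  shows "bij_betw
    (\<lambda>P. filter_mset (\<lambda>x. x \<noteq> d * k) P
        + replicate_mset (count P (d * k) mod r) (d * k)
        + replicate_mset (count P (d * k) div r) (d * r * k))
    (merge_stage d r k n) (merge_stage d r (Suc k) n)"
    (is "bij_betw ?f ?A ?B")
proof -
  define a where "a = d * k"
  define b where "b = d * r * k"
  have pos: "a > 0" "b > 0" and b_eq: "b = r * a"
    using d r k by (auto simp: a_def b_def)
  have ab: "a \<noteq> b" using r pos b_eq by auto
  have below_a: "d * j \<noteq> a" if "j < k" for j using that d by (auto simp: a_def)
  have below_b: "d * j \<noteq> b" if "j \<le> k" for j
  proof -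
    have "d * j \<le> a" using that by (simp add: a_def)
    also have "a < b" using r pos b_eq by simp
    finally show ?thesis by simp
  qed
  have above_a: "d * r * j \<noteq> a" if "j \<ge> k" for j
  proof -
    have "b \<le> d * r * j" using that by (simp add: b_def)
    moreover have "a < b" using r pos b_eq by simp
    ultimately show ?thesis by simp
  qed
  have above_b: "d * r * j \<noteq> b" if "j > k" for j using that d r by (auto simp: b_def)
  define f where "f = (\<lambda>P. filter_mset (\<lambda>x. x \<noteq> a) P
    + replicate_mset (count P a mod r) a + replicate_mset (count P a div r) b)"
  define g where "g = (\<lambda>Q. filter_mset (\<lambda>x. x \<noteq> b) Q + replicate_mset (r * count Q b) a)"
  have split: "sum_mset P = sum_mset (filter_mset (\<lambda>x. x \<noteq> c) P) + count P c * c"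
    for P :: "nat multiset" and c
  proof -
    have "P = filter_mset (\<lambda>x. x \<noteq> c) P + replicate_mset (count P c) c"
      by (rule multiset_eqI) auto
    then have "sum_mset P = sum_mset (filter_mset (\<lambda>x. x \<noteq> c) P + replicate_mset (count P c) c)"
      by simp
    then show ?thesis by simp
  qed
  have sum_f: "sum_mset (f P) = sum_mset P" for P
  proof -
    have "count P a * a = (count P a mod r) * a + (count P a div r) * b"
      by (metis b_eq add.commute div_mult_mod_eq distrib_right mult.assoc)
    then show ?thesis using split[of P a] by (simp add: f_def)
  qed
  have sum_g: "sum_mset (g Q) = sum_mset Q" for Q
    using split[of Q b] by (simp add: g_def b_eq)
  have count_f: "count (f P) x = (if x = a then count P a mod r
      else if x = b then count P b + count P a div r else count P x)" for P x
    using ab by (auto simp: f_def)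
  have count_g: "count (g Q) x = (if x = b then 0
      else if x = a then count Q a + r * count Q b else count Q x)" for Q x
    using ab by (auto simp: g_def)
  have "bij_betw f ?A ?B"
  proof (rule bij_betw_byWitness[where f' = g])
    show "\<forall>P\<in>?A. g (f P) = P"
    proof (intro ballI multiset_eqI)
      fix P x assume "P \<in> ?A"
      then have "count P b = 0" by (auto simp: merge_stage_def b_def)
      then show "count (g (f P)) x = count P x"
        using ab by (auto simp: count_f count_g)
    qed
    show "\<forall>Q\<in>?B. f (g Q) = Q"
    proof (intro ballI multiset_eqI)
      fix Q x assume "Q \<in> ?B"
      then have "count Q a < r" by (auto simp: merge_stage_def a_def)
      then show "count (f (g Q)) x = count Q x"
        using ab r by (auto simp: count_f count_g)
    qed
    show "f ` ?A \<subseteq> ?B"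
    proof (intro image_subsetI)
      fix P assume P: "P \<in> ?A"
      have "count (f P) 0 = 0"
        using P pos by (auto simp: count_f merge_stage_def partitions_of_def not_in_iff)
      moreover have "count (f P) (d * j) < r" if "j < Suc k" for j
        using that P r below_a[of j] below_b[of j]
        by (cases "j = k") (auto simp: count_f merge_stage_def a_def)
      moreover have "count (f P) (d * r * j) = 0" if "j \<ge> Suc k" for j
        using that P above_a[of j] above_b[of j] by (auto simp: count_f merge_stage_def)
      ultimately show "f P \<in> ?B"
        using P sum_f[of P] by (simp add: merge_stage_def partitions_of_def not_in_iff)
    qed
    show "g ` ?B \<subseteq> ?A"
    proof (intro image_subsetI)
      fix Q assume Q: "Q \<in> ?B"
      have "count (g Q) 0 = 0"
        using Q pos by (auto simp: count_g merge_stage_def partitions_of_def not_in_iff)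
      moreover have "count (g Q) (d * j) < r" if "j < k" for j
        using that Q r below_a[of j] below_b[of j] by (auto simp: count_g merge_stage_def)
      moreover have "count (g Q) (d * r * j) = 0" if "j \<ge> k" for j
        using that Q above_a[of j] by (cases "j = k") (auto simp: count_g merge_stage_def b_def)
      ultimately show "g Q \<in> ?A"
        using Q sum_g[of Q] by (simp add: merge_stage_def partitions_of_def not_in_iff)
    qed
  qed
  then show ?thesis by (simp add: f_def a_def b_def)
qed

lemma card_merge_stage:
  assumes "d > 0" "r \<ge> 2"
  shows "card (merge_stage d r (Suc k) n) = card (merge_stage d r 1 n)"
proof (induction k)
  case (Suc k)
  then show ?case
    using bij_betw_same_card[OF bij_betw_merge_stage[OF assms, of "Suc k" n]] by simp
qed simp

text \<open>
  This extends Glaisher's theorem, which is the case \<open>d = 1\<close>, and Euler's, which is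
  \<open>d = 1\<close>, \<open>r = 2\<close>. Before any merging the class consists of the \<open>d r\<close>-regular partitions; once
  \<open>k\<close> exceeds \<open>n\<close>, every multiple of \<open>d\<close> that can occur has been reduced.
\<close>

theorem reg_mult_eq_card_few_multiples:
  assumes d: "d > 0" and r: "r \<ge> 2"
  shows "reg (d * r) n = card {P \<in> partitions_of n. \<forall>k. d dvd k \<longrightarrow> count P k < r}"
proof -
  have first: "merge_stage d r 1 n = {P \<in> partitions_of n. \<forall>k\<in>#P. \<not> d * r dvd k}"
  proof -
    have "(\<forall>j<1. count P (d * j) < r) \<and> (\<forall>j\<ge>1. count P (d * r * j) = 0)
        \<longleftrightarrow> (\<forall>k\<in>#P. \<not> d * r dvd k)" if "P \<in> partitions_of n" for P
    proof -
      have 0: "count P 0 = 0" using that by (simp add: partitions_of_def not_in_iff)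
      have "(\<forall>j\<ge>1. count P (d * r * j) = 0) \<longleftrightarrow> (\<forall>j. count P (d * r * j) = 0)"
        using 0 by (metis less_one mult_0_right not_le)
      moreover have "count P 0 < r" using 0 r by simp
      ultimately show ?thesis by (auto simp: dvd_def count_eq_zero_iff)
    qed
    then show ?thesis unfolding merge_stage_def by blast
  qed
  have last: "merge_stage d r (Suc n) n
      = {P \<in> partitions_of n. \<forall>k. d dvd k \<longrightarrow> count P k < r}"
  proof -
    have "(\<forall>j<Suc n. count P (d * j) < r) \<and> (\<forall>j\<ge>Suc n. count P (d * r * j) = 0)
        \<longleftrightarrow> (\<forall>k. d dvd k \<longrightarrow> count P k < r)" if P: "P \<in> partitions_of n" for P
    proof -
      have large: "count P (c * j) = 0" if "c > 0" "j \<ge> Suc n" for c j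
      proof -
        have "1 * j \<le> c * j" by (rule mult_right_mono) (use that in auto)
        then have "c * j > n" using that by linarith
        moreover have "x \<le> n" if x: "x \<in># P" for x
        proof -
          obtain R where "P = add_mset x R" using x by (meson multi_member_split)
          then show ?thesis using P by (auto simp: partitions_of_def)
        qed
        ultimately have "c * j \<notin># P" by (meson not_le)
        then show ?thesis by (simp add: not_in_iff)
      qed
      have "count P (d * j) < r" if "\<forall>j<Suc n. count P (d * j) < r" for j
        using that large[OF d, of j] r by (cases "j < Suc n") auto
      moreover have "count P (d * r * j) = 0" if "j \<ge> Suc n" for j
        using large[of "d * r" j] d r that by simp
      ultimately show ?thesis by (auto simp: dvd_def)
    qed
    then show ?thesis unfolding merge_stage_def by blast
  qed
  show ?thesis
    using card_merge_stage[OF d r, of n n] unfolding first last reg_def by simp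
qed

section \<open>Partitions without repeated even parts\<close>

definition even_distinct_partitions :: "nat \<Rightarrow> nat multiset set" where
  "even_distinct_partitions n = {P \<in> partitions_of n. \<forall>k. even k \<longrightarrow> count P k \<le> 1}"

lemma DE_e1_eq_card:
  "DE_e1 n = card {P \<in> even_distinct_partitions n. P \<noteq> {#} \<and> even (Max (set_mset P))}"
proof -
  have "count P (Max (set_mset P)) = 1"
    if "\<forall>k. even k \<longrightarrow> count P k \<le> 1" "P \<noteq> {#}" "even (Max (set_mset P))" for P :: "nat multiset"
  proof -
    have "Max (set_mset P) \<in># P" using that by simp
    then show ?thesis using that by (metis count_greater_eq_one_iff le_antisym)
  qed
  then show ?thesis
    unfolding DE_e1_def even_distinct_partitions_def by (intro arg_cong[where f = card]) auto
qed

lemma Max_mset_add_mset_eq: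
  fixes x :: nat
  assumes "\<And>y. y \<in># R \<Longrightarrow> y \<le> x"
  shows "Max (set_mset (add_mset x R)) = x"
  by (rule Max_eqI) (use assms in auto)

text \<open>
  The inverse lowers the largest part \<open>M\<close> by \<open>1\<close>. As \<open>M\<close> is even, it occurs only once, so all
  other parts are at most \<open>M - 1\<close>, and \<open>M - 1\<close> is again the largest part.
\<close>

lemma bij_betw_raise_Max:
  "bij_betw (\<lambda>P. add_mset (Suc (Max (set_mset P))) (P - {#Max (set_mset P)#}))
     {P \<in> even_distinct_partitions n. P \<noteq> {#} \<and> odd (Max (set_mset P))}
     {P \<in> even_distinct_partitions (Suc n). P \<noteq> {#} \<and> even (Max (set_mset P))}"
  (is "bij_betw ?f ?A ?B")
proof -
  define g where "g = (\<lambda>Q :: nat multiset. let M = Max (set_mset Q)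
    in add_mset (M - 1) (Q - {#M#}))"
  have f: "?f P \<in> ?B \<and> g (?f P) = P" if "P \<in> ?A" for P
  proof -
    define M where "M = Max (set_mset P)"
    have "M \<in># P" using that by (simp add: M_def)
    then obtain R where R: "P = add_mset M R" by (meson multi_member_split)
    have le: "y \<le> M" if "y \<in># R" for y
    proof -
      have "y \<in># P" using that by (simp add: R)
      then show ?thesis by (simp add: M_def)
    qed
    have "P - {#M#} = R" by (simp add: R)
    then have fP: "?f P = add_mset (Suc M) R" by (simp add: M_def)
    have Max: "Max (set_mset (add_mset (Suc M) R)) = Suc M"
      by (rule Max_mset_add_mset_eq) (use le in fastforce)
    have new: "count R (Suc M) = 0" using le by (metis not_in_iff Suc_n_not_le_n)
    have odd: "odd M" using that by (simp add: M_def)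
    have part: "P \<in> partitions_of n" and dist: "\<And>k. even k \<Longrightarrow> count P k \<le> 1"
      using that by (auto simp: even_distinct_partitions_def)
    have "count (add_mset (Suc M) R) k \<le> 1" if "even k" for k
      using dist[OF that] new by (cases "k = Suc M") (auto simp: R split: if_splits)
    moreover have "add_mset (Suc M) R \<in> partitions_of (Suc n)"
      using part by (auto simp: partitions_of_def R)
    ultimately have "?f P \<in> ?B"
      unfolding fP using Max odd by (simp add: even_distinct_partitions_def)
    moreover have "g (?f P) = P" unfolding fP g_def Let_def Max by (simp add: R)
    ultimately show ?thesis ..
  qed
  have g: "g Q \<in> ?A \<and> ?f (g Q) = Q" if "Q \<in> ?B" for Q
  proof -
    define M where "M = Max (set_mset Q)"
    have "M \<in># Q" using that by (simp add: M_def)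
    then obtain R where R: "Q = add_mset M R" by (meson multi_member_split)
    have part: "Q \<in> partitions_of (Suc n)" and dist: "\<And>k. even k \<Longrightarrow> count Q k \<le> 1"
      using that by (auto simp: even_distinct_partitions_def)
    have even: "even M" using that by (simp add: M_def)
    have "M \<noteq> 0" using part by (auto simp: partitions_of_def R)
    then obtain L where L: "M = Suc L" by (meson not0_implies_Suc)
    then have "odd L" "L > 0" using even by (auto intro: odd_pos)
    have "Q - {#M#} = R" by (simp add: R)
    then have gQ: "g Q = add_mset L R"
      unfolding g_def Let_def M_def[symmetric] by (simp add: L)
    have "count R M = 0" using dist[OF even] by (simp add: R)
    then have le: "y \<le> L" if "y \<in># R" for y
    proof -
      have "y \<in># Q" using that by (simp add: R)
      then have "y \<le> M" by (simp add: M_def)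
      moreover have "y \<noteq> M" using that \<open>count R M = 0\<close> by (auto simp: count_eq_zero_iff)
      ultimately show ?thesis by (simp add: L)
    qed
    have Max: "Max (set_mset (add_mset L R)) = L"
      by (rule Max_mset_add_mset_eq) (rule le)
    have "count (add_mset L R) k \<le> 1" if "even k" for k
      using dist[OF that] that \<open>odd L\<close> by (auto simp: R split: if_splits)
    moreover have "add_mset L R \<in> partitions_of n"
      using part \<open>L > 0\<close> by (auto simp: partitions_of_def R L)
    ultimately have "g Q \<in> ?A"
      unfolding gQ using Max \<open>odd L\<close> by (simp add: even_distinct_partitions_def)
    moreover have "?f (g Q) = Q" unfolding gQ Max by (simp add: R L)
    ultimately show ?thesis ..
  qed
  show ?thesis
  proof (rule bij_betw_byWitness[where f' = g])
    show "\<forall>P\<in>?A. g (?f P) = P" by (rule ballI) (rule conjunct2[OF f])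
    show "\<forall>Q\<in>?B. ?f (g Q) = Q" by (rule ballI) (rule conjunct2[OF g])
    show "?f ` ?A \<subseteq> ?B" by (rule image_subsetI) (rule conjunct1[OF f])
    show "g ` ?B \<subseteq> ?A" by (rule image_subsetI) (rule conjunct1[OF g])
  qed
qed

text \<open>
  Positivity of \<open>n\<close> excludes the empty partition, which \<open>reg\<close> counts and \<open>DE_e1\<close> does not.
\<close>

lemma DE_e1_Suc_add:
  assumes "n > 0"
  shows "DE_e1 (Suc n) + DE_e1 n = reg 4 n"
proof -
  let ?E = "even_distinct_partitions n"
  let ?odd = "{P \<in> ?E. P \<noteq> {#} \<and> odd (Max (set_mset P))}"
  let ?even = "{P \<in> ?E. P \<noteq> {#} \<and> even (Max (set_mset P))}"
  have fin: "finite ?E"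
    unfolding even_distinct_partitions_def using finite_partitions_of by simp
  have "{#} \<notin> ?E"
    using assms by (auto simp: even_distinct_partitions_def partitions_of_def)
  then have split: "?E = ?odd \<union> ?even" by auto
  have "count P k < 2 \<longleftrightarrow> count P k \<le> 1" for P :: "nat multiset" and k by auto
  then have "reg 4 n = card ?E"
    using reg_mult_eq_card_few_multiples[of 2 2 n]
    by (simp add: even_distinct_partitions_def)
  also have "\<dots> = card ?odd + card ?even"
    by (subst split, rule card_Un_disjoint) (use fin in auto)
  also have "card ?odd = DE_e1 (Suc n)"
    unfolding DE_e1_eq_card by (rule bij_betw_same_card[OF bij_betw_raise_Max])
  also have "card ?even = DE_e1 n"
    by (simp only: DE_e1_eq_card)
  finally show ?thesis by simp
qed

lemma DE_e1_1: "DE_e1 1 = 0"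
proof -
  have "odd (Max (set_mset P))" if P: "P \<in> partitions_of 1" "P \<noteq> {#}" for P
  proof -
    define M where "M = Max (set_mset P)"
    have "M \<in># P" using P by (simp add: M_def)
    then obtain R where "P = add_mset M R" by (meson multi_member_split)
    then have "M \<noteq> 0" "M + sum_mset R = 1" using P by (auto simp: partitions_of_def)
    then have "odd M" by (cases M) auto
    then show ?thesis unfolding M_def .
  qed
  then have "{P \<in> even_distinct_partitions 1. P \<noteq> {#} \<and> even (Max (set_mset P))} = {}"
    unfolding even_distinct_partitions_def by blast
  then show ?thesis by (simp only: DE_e1_eq_card card.empty)
qed

section \<open>The alternating sum\<close>

theorem theorem6:
  fixes n :: nat
  assumes "n \<ge> 2"
  shows "int (DE_e1 n) = (\<Sum>i = 0..n - 2. (- 1) ^ i * int (reg 4 (n - 1 - i)))"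
proof -
  have "int (DE_e1 (Suc (Suc m))) = (\<Sum>i\<le>m. (- 1) ^ i * int (reg 4 (Suc m - i)))" for m
  proof (induction m)
    case 0
    show ?case using DE_e1_Suc_add[of 1] DE_e1_1 by simp
  next
    case (Suc m)
    have "int (DE_e1 (Suc (Suc (Suc m))))
        = int (reg 4 (Suc (Suc m))) - int (DE_e1 (Suc (Suc m)))"
      using DE_e1_Suc_add[of "Suc (Suc m)"] by simp
    also have "\<dots> = (\<Sum>i\<le>Suc m. (- 1) ^ i * int (reg 4 (Suc (Suc m) - i)))"
      unfolding Suc.IH by (subst sum.atMost_Suc_shift) (simp add: sum_negf)
    finally show ?case .
  qed
  moreover obtain m where "n = Suc (Suc m)"
    using assms by (metis add_2_eq_Suc le_Suc_ex)
  ultimately show ?thesis by (simp add: atMost_atLeast0)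
qed

end
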